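(* Fix a notion of smallness on subclasses of $2^\omega$. Let $\mathsf{P}$ and $\mathsf{Q}$ be problems. If $\mathsf{P}$ is frequently solved and $\mathsf{Q}$ has a rarely-solved instance $X$, then $\mathsf{Q} \not\leq_\omega \mathsf{P}$.
   Context: Elements of $2^\omega$ are identified with subsets of $\omega$ and called sets; subsets of $2^\omega$ are called classes. $X\oplus Y=\{2n:n\in X\}\cup\{2n+1:n\in Y\}$ is the effective join and $\leq_T$ is Turing reducibility. A notion of smallness is a property of classes $\mathcal{C}\subseteq 2^\omega$, called being small, such that: (1) $\emptyset$ is small and $2^\omega$ is not; (2) if $\mathcal{B}$ is small and $\mathcal{A}\subseteq\mathcal{B}$, then $\mathcal{A}$ is small; (3) if $\mathcal{B}_i$ is small for all $i\in\omega$, then $\bigcup_{i\in\omega}\mathcal{B}_i$ is small; (4) if $\mathcal{S}$ is small, then $\mathcal{B}(\mathcal{S})=\{X : \{Z: X\oplus Z\in\mathcal{S}\}\text{ is not small}\}$ is small. A problem is a relation $\mathsf{P}\subseteq 2^\omega\times 2^\omega$. A $\mathsf{P}$-instance is an element of $\operatorname{dom}\mathsf{P}=\{X:\exists Y\,(X,Y)\in\mathsf{P}\}$, and a $\mathsf{P}$-solution to an instance $X$ is a set $Y$ with $(X,Y)\in\mathsf{P}$. A $\mathsf{P}$-instance $X$ is rarely solved if $\{Z: \exists Y\leq_T X\oplus Z\ (Y\text{ is a }\mathsf{P}\text{-solution to }X)\}$ is small. The problem $\mathsf{P}$ is frequently solved if for every $\mathsf{P}$-instance $X$ the class $\{Z: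 \exists Y\leq_T X\oplus Z\ (Y\text{ is a }\mathsf{P}\text{-solution to }X)\}$ is not small. A Turing ideal $\mathcal{M}$ is a non-empty collection of sets that is closed downward under $\leq_T$ and closed under $\oplus$. A problem $\mathsf{P}$ holds in $\mathcal{M}$, written $\mathcal{M}\models\mathsf{P}$, if every $\mathsf{P}$-instance $X\in\mathcal{M}$ has a $\mathsf{P}$-solution $Y\in\mathcal{M}$. $\mathsf{Q}\leq_\omega\mathsf{P}$ means that for every Turing ideal $\mathcal{M}$, if $\mathcal{M}\models\mathsf{P}$ then $\mathcal{M}\models\mathsf{Q}$. *)

theory Defs
  imports Main
begin

text \<open>
  Relative computability is given by the partial recursive functions with an oracle, as programs
  with a big-step semantics. Programs do not carry an arity: \<open>eval A f xs y\<close> says that \<open>f\<close>,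
  run with oracle \<open>A\<close> on the argument tuple \<open>xs\<close>, halts with output \<open>y\<close>. Where no rule
  applies, as for \<open>Succ\<close> on a tuple that is not of length one, the program diverges; on tuples of
  any fixed length the programs compute exactly the partial recursive functions relative to \<open>A\<close>
  of that arity. \<open>Orc\<close> queries the
  characteristic function of the oracle, \<open>Prec\<close> recurses on the first argument, and \<open>Mu\<close>
  searches for a zero in the first argument, all earlier values being required to be
  defined and non-zero.
\<close>

datatype prog =
    Zero
  | Succ
  | Proj nat
  | Orc
  | Comp prog "prog list"
  | Prec prog prog
  | Mu prog

inductive eval :: "nat set \<Rightarrow> prog \<Rightarrow> nat list \<Rightarrow> nat \<Rightarrow> bool" for A :: "nat set" where
  eval_Zero: "eval A Zero xs 0"
| eval_Succ: "eval A Succ [x] (Suc x)"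
| eval_Proj: "i < length xs \<Longrightarrow> eval A (Proj i) xs (xs ! i)"
| eval_Orc: "eval A Orc [x] (if x \<in> A then 1 else 0)"
| eval_Comp: "list_all2 (\<lambda>g y. eval A g xs y) gs ys \<Longrightarrow> eval A f ys z \<Longrightarrow> eval A (Comp f gs) xs z"
| eval_Prec_0: "eval A f xs y \<Longrightarrow> eval A (Prec f g) (0 # xs) y"
| eval_Prec_Suc: "eval A (Prec f g) (n # xs) r \<Longrightarrow> eval A g (n # r # xs) y
    \<Longrightarrow> eval A (Prec f g) (Suc n # xs) y"
| eval_Mu: "eval A f (n # xs) 0 \<Longrightarrow> (\<And>m. m < n \<Longrightarrow> \<exists>k. eval A f (m # xs) (Suc k))
    \<Longrightarrow> eval A (Mu f) xs n"

definition turing_le :: "nat set \<Rightarrow> nat set \<Rightarrow> bool" (infix "\<le>\<^sub>T" 50) where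
  "Y \<le>\<^sub>T X \<longleftrightarrow> (\<exists>f. \<forall>n. eval X f [n] (if n \<in> Y then 1 else 0))"

definition join :: "nat set \<Rightarrow> nat set \<Rightarrow> nat set" (infixl "\<oplus>" 65) where
  "X \<oplus> Y = {2 * n | n. n \<in> X} \<union> {2 * n + 1 | n. n \<in> Y}"

definition smallness_notion :: "(nat set set \<Rightarrow> bool) \<Rightarrow> bool" where
  "smallness_notion small \<longleftrightarrow>
     small {} \<and> \<not> small UNIV \<and>
     (\<forall>\<A> \<B>. small \<B> \<longrightarrow> \<A> \<subseteq> \<B> \<longrightarrow> small \<A>) \<and>
     (\<forall>\<B> :: nat \<Rightarrow> nat set set. (\<forall>i. small (\<B> i)) \<longrightarrow> small (\<Union>i. \<B> i)) \<and>
     (\<forall>\<S>. small \<S> \<longrightarrow> small {X. \<not> small {Z. X \<oplus> Z \<in> \<S>}})"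

text \<open>The instances of a problem \<open>P\<close> are the elements of \<^term>\<open>Domain P\<close>.\<close>

type_synonym problem = "(nat set \<times> nat set) set"

definition solving_class :: "problem \<Rightarrow> nat set \<Rightarrow> nat set set" where
  "solving_class P X = {Z. \<exists>Y. Y \<le>\<^sub>T X \<oplus> Z \<and> (X, Y) \<in> P}"

definition rarely_solved_instance :: "(nat set set \<Rightarrow> bool) \<Rightarrow> problem \<Rightarrow> nat set \<Rightarrow> bool" where
  "rarely_solved_instance small P X \<longleftrightarrow> X \<in> Domain P \<and> small (solving_class P X)"

definition frequently_solved :: "(nat set set \<Rightarrow> bool) \<Rightarrow> problem \<Rightarrow> bool" where
  "frequently_solved small P \<longleftrightarrow> (\<forall>X \<in> Domain P. \<not> small (solving_class P X))"

definition turing_ideal :: "nat set set \<Rightarrow> bool" where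
  "turing_ideal M \<longleftrightarrow>
     M \<noteq> {} \<and>
     (\<forall>X \<in> M. \<forall>Y. Y \<le>\<^sub>T X \<longrightarrow> Y \<in> M) \<and>
     (\<forall>X \<in> M. \<forall>Y \<in> M. X \<oplus> Y \<in> M)"

definition holds_in :: "nat set set \<Rightarrow> problem \<Rightarrow> bool" where
  "holds_in M P \<longleftrightarrow> (\<forall>X \<in> Domain P \<inter> M. \<exists>Y \<in> M. (X, Y) \<in> P)"

definition omega_reducible :: "problem \<Rightarrow> problem \<Rightarrow> bool" (infix "\<le>\<^sub>\<omega>" 50) where
  "Q \<le>\<^sub>\<omega> P \<longleftrightarrow> (\<forall>M. turing_ideal M \<longrightarrow> holds_in M P \<longrightarrow> holds_in M Q)"

end

theory Submission
  imports Defs "HOL-Library.Countable"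
begin

text \<open>
  The separating ideal is generated by an increasing sequence \<open>W\<^sub>0 = X\<close>, \<open>W\<^sub>1\<close>, \<open>W\<^sub>2\<close>, \<dots>. A step passes
  from \<open>W\<close> to a join \<open>W \<oplus> Z\<close> that solves one more \<open>P\<close>-instance, while no \<open>W\<^sub>n\<close> ever computes a
  \<open>Q\<close>-solution to \<open>X\<close>. Merely avoiding such a solution is not an invariant that can be
  carried along; the right one is that \<open>W\<close> is \<^emph>\<open>safe\<close>: with \<open>U\<close> the class of all sets that compute a
  \<open>Q\<close>-solution to \<open>X\<close>, the class \<open>{Z. W \<oplus> Z \<in> U}\<close> is small. For an instance
  \<open>X\<close>, being rarely solved means exactly being safe, and a safe \<open>W\<close> is not in \<open>U\<close>, because \<open>U\<close> is closed
  upwards under Turing reducibility and the class of all sets is not small.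

  The Fubini-like axiom of a notion of smallness, applied to \<open>{Z. W \<oplus> Z \<in> U}\<close>, says that the
  class of \<open>Z\<close> for which \<open>W \<oplus> Z\<close> is not safe is small, up to reassociating the join
  (\<open>small_unsafe_joins\<close>). For a \<open>P\<close>-instance \<open>Y\<close> computable from \<open>W\<close>, the class of
  \<open>Z\<close> such that \<open>Y \<oplus> Z\<close> computes a solution is not small, so some such \<open>Z\<close> makes \<open>W \<oplus> Z\<close> safe
  (\<open>safe_extension\<close>).

  A set computes only countably many sets, so a bookkeeping argument treats every \<open>P\<close>-instance
  computable from some \<open>W\<^sub>n\<close> at a later stage (\<open>ideal_from_extensions\<close>). The sets computable
  from some \<open>W\<^sub>n\<close> then form a Turing ideal in which \<open>P\<close> holds and \<open>Q\<close> fails at \<open>X\<close>.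
\<close>

section \<open>Programs and determinism\<close>

text \<open>
  Determinism makes the set computed by a program with a given oracle unique, so that
  the countability of programs passes to the sets computable from one oracle.
\<close>

lemma eval_deterministic:
  assumes "eval A f xs y" and "eval A f xs z"
  shows "y = z"
  using assms
proof (induction arbitrary: z rule: eval.induct)
  case (eval_Comp xs gs ys f y)
  from eval_Comp.prems obtain zs where
    zs: "list_all2 (\<lambda>g z. eval A g xs z) gs zs" "eval A f zs z"
    by cases auto
  have "ys = zs"
  proof (rule nth_equalityI)
    show "length ys = length zs"
      using list_all2_lengthD[OF eval_Comp.IH(1)] list_all2_lengthD[OF zs(1)] by simp
  next
    fix i assume "i < length ys"
    moreover from this have "i < length gs"
      using list_all2_lengthD[OF zs(1)] list_all2_lengthD[OF eval_Comp.IH(1)] by simp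
    ultimately show "ys ! i = zs ! i"
      using list_all2_nthD[OF eval_Comp.IH(1)] list_all2_nthD[OF zs(1)] by simp
  qed
  then show ?case using eval_Comp.IH(2) zs(2) by blast
next
  case (eval_Prec_Suc f g n xs r y)
  from eval_Prec_Suc.prems obtain r' where
    "eval A (Prec f g) (n # xs) r'" "eval A g (n # r' # xs) z"
    by cases auto
  then show ?case using eval_Prec_Suc.IH by blast
next
  case (eval_Mu f n xs)
  from eval_Mu.prems have z: "eval A f (z # xs) 0" "\<And>m. m < z \<Longrightarrow> \<exists>k. eval A f (m # xs) (Suc k)"
    by (cases, auto)+
  (* Either search result lies strictly before the other only if the same value is both zero
     and non-zero there. *)
  have "\<not> n < z" using z(2) eval_Mu.IH(1) by fastforce
  moreover have "\<not> z < n" using z(1) eval_Mu.IH(2) by fastforce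
  ultimately show ?case by simp
next
  case (eval_Zero xs)
  then show ?case by cases simp
next
  case (eval_Succ x)
  then show ?case by cases simp
next
  case (eval_Proj i xs)
  from eval_Proj.prems show ?case by cases simp
next
  case (eval_Orc x)
  then show ?case by cases simp
next
  case (eval_Prec_0 f xs y g)
  from eval_Prec_0.prems show ?case by cases (simp_all add: eval_Prec_0.IH)
qed

lemma eval_Proj_nth: "i < length xs \<Longrightarrow> xs ! i = y \<Longrightarrow> eval A (Proj i) xs y"
  using eval_Proj by blast

lemma eval_Comp_unary: "eval A g xs y \<Longrightarrow> eval A f [y] z \<Longrightarrow> eval A (Comp f [g]) xs z"
  by (rule eval_Comp[where ys = "[y]"]) auto

definition double_prog :: prog where
  "double_prog = Prec Zero (Comp Succ [Comp Succ [Proj 1]])"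

definition not_prog :: prog where
  "not_prog = Prec (Comp Succ [Zero]) Zero"

definition parity_prog :: prog where
  "parity_prog = Prec Zero (Comp not_prog [Proj 1])"

definition add_prog :: prog where
  "add_prog = Prec (Proj 0) (Comp Succ [Proj 1])"

text \<open>The recursion is \<open>(n + 1) div 2 = n mod 2 + n div 2\<close>.\<close>

definition half_prog :: prog where
  "half_prog = Prec Zero (Comp add_prog [Comp parity_prog [Proj 0], Proj 1])"

definition cond_prog :: prog where
  "cond_prog = Prec (Proj 0) (Proj 3)"

lemma eval_double: "eval A double_prog [n] (2 * n)"
proof (induction n)
  case 0
  show ?case by (simp add: double_prog_def eval_Prec_0 eval_Zero)
next
  case (Suc n)
  have "eval A (Comp Succ [Comp Succ [Proj 1]]) [n, 2 * n] (Suc (Suc (2 * n)))"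
    by (rule eval_Comp_unary[OF eval_Comp_unary[OF eval_Proj_nth eval_Succ] eval_Succ]) auto
  with Suc show ?case
    by (auto simp: double_prog_def intro: eval_Prec_Suc)
qed

lemma eval_not: "eval A not_prog [n] (if n = 0 then 1 else 0)"
proof (induction n)
  case 0
  have "eval A (Comp Succ [Zero]) [] (Suc 0)"
    by (rule eval_Comp_unary[OF eval_Zero eval_Succ])
  then show ?case by (simp add: not_prog_def eval_Prec_0)
next
  case (Suc n)
  then show ?case by (auto simp: not_prog_def intro: eval_Prec_Suc eval_Zero)
qed

lemma eval_parity: "eval A parity_prog [n] (n mod 2)"
proof (induction n)
  case 0
  show ?case by (simp add: parity_prog_def eval_Prec_0 eval_Zero)
next
  case (Suc n)
  have "eval A (Comp not_prog [Proj 1]) [n, n mod 2] (if n mod 2 = 0 then 1 else 0)"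
    by (rule eval_Comp_unary[OF eval_Proj_nth eval_not]) auto
  moreover have "(if n mod 2 = 0 then 1 else 0) = Suc n mod 2"
    by presburger
  ultimately show ?case
    using Suc by (auto simp: parity_prog_def intro: eval_Prec_Suc)
qed

lemma eval_add: "eval A add_prog [m, n] (m + n)"
proof (induction m)
  case 0
  show ?case by (simp add: add_prog_def eval_Prec_0 eval_Proj_nth)
next
  case (Suc m)
  have "eval A (Comp Succ [Proj 1]) [m, m + n, n] (Suc (m + n))"
    by (rule eval_Comp_unary[OF eval_Proj_nth eval_Succ]) auto
  with Suc show ?case by (auto simp: add_prog_def intro: eval_Prec_Suc)
qed

lemma eval_half: "eval A half_prog [n] (n div 2)"
proof (induction n)
  case 0
  show ?case by (simp add: half_prog_def eval_Prec_0 eval_Zero)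
next
  case (Suc n)
  have "eval A (Comp parity_prog [Proj 0]) [n, n div 2] (n mod 2)"
    by (rule eval_Comp_unary[OF eval_Proj_nth eval_parity]) auto
  moreover have "eval A (Proj 1) [n, n div 2] (n div 2)"
    by (intro eval_Proj_nth) auto
  ultimately have "eval A (Comp add_prog [Comp parity_prog [Proj 0], Proj 1]) [n, n div 2]
      (n mod 2 + n div 2)"
    by (intro eval_Comp[where ys = "[n mod 2, n div 2]"] eval_add) auto
  moreover have "n mod 2 + n div 2 = Suc n div 2"
    by presburger
  ultimately show ?case
    using Suc by (auto simp: half_prog_def intro: eval_Prec_Suc)
qed

lemma eval_cond: "eval A cond_prog [n, a, b] (if n = 0 then a else b)"
proof (induction n)
  case 0
  show ?case by (simp add: cond_prog_def eval_Prec_0 eval_Proj_nth)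
next
  case (Suc n)
  then show ?case by (auto simp: cond_prog_def intro!: eval_Prec_Suc eval_Proj_nth)
qed


section \<open>Turing reducibility and joins\<close>

lemma turing_le_refl: "A \<le>\<^sub>T A"
  unfolding turing_le_def using eval_Orc by blast

primrec replace_oracle :: "prog \<Rightarrow> prog \<Rightarrow> prog" where
  "replace_oracle h Zero = Zero"
| "replace_oracle h Succ = Succ"
| "replace_oracle h (Proj i) = Proj i"
| "replace_oracle h Orc = h"
| "replace_oracle h (Comp f gs) = Comp (replace_oracle h f) (map (replace_oracle h) gs)"
| "replace_oracle h (Prec f g) = Prec (replace_oracle h f) (replace_oracle h g)"
| "replace_oracle h (Mu f) = Mu (replace_oracle h f)"

lemma eval_replace_oracle:
  assumes "\<And>n. eval A h [n] (if n \<in> B then 1 else 0)"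
    and "eval B f xs y"
  shows "eval A (replace_oracle h f) xs y"
  using assms(2)
proof (induction rule: eval.induct)
  case (eval_Comp xs gs ys f z)
  have "list_all2 (\<lambda>g y. eval A g xs y) (map (replace_oracle h) gs) ys"
    unfolding list_all2_map1 using eval_Comp.IH(1) by (rule list_all2_mono) auto
  then show ?case using eval_Comp.IH(2) by (auto intro: eval.eval_Comp)
next
  case (eval_Mu f n xs)
  then show ?case by (auto intro!: eval.eval_Mu)
next
  case (eval_Prec_Suc f g n xs r y)
  then show ?case by (auto intro: eval.eval_Prec_Suc)
qed (simp_all add: assms(1) eval.eval_Zero eval.eval_Succ eval.eval_Proj eval.eval_Prec_0)

lemma turing_le_trans [trans]:
  assumes "A \<le>\<^sub>T B" and "B \<le>\<^sub>T C"
  shows "A \<le>\<^sub>T C"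
  using assms eval_replace_oracle unfolding turing_le_def by meson

lemma mem_join: "n \<in> A \<oplus> B \<longleftrightarrow> (if even n then n div 2 \<in> A else n div 2 \<in> B)"
  unfolding join_def by (auto elim!: evenE oddE; presburger)

lemma turing_le_join1: "A \<le>\<^sub>T A \<oplus> B"
  unfolding turing_le_def
proof (intro exI allI)
  fix n
  have "2 * n \<in> A \<oplus> B \<longleftrightarrow> n \<in> A" by (simp add: mem_join)
  with eval_Orc[of "A \<oplus> B" "2 * n"]
  show "eval (A \<oplus> B) (Comp Orc [double_prog]) [n] (if n \<in> A then 1 else 0)"
    by (intro eval_Comp_unary[OF eval_double]) simp
qed

lemma turing_le_join2: "B \<le>\<^sub>T A \<oplus> B"
  unfolding turing_le_def
proof (intro exI allI)
  fix n
  have "Suc (2 * n) \<in> A \<oplus> B \<longleftrightarrow> n \<in> B" by (simp add: mem_join)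
  with eval_Orc[of "A \<oplus> B" "Suc (2 * n)"]
  show "eval (A \<oplus> B) (Comp Orc [Comp Succ [double_prog]]) [n] (if n \<in> B then 1 else 0)"
    by (intro eval_Comp_unary[OF eval_Comp_unary[OF eval_double eval_Succ]]) simp
qed

lemma join_turing_le:
  assumes "A \<le>\<^sub>T C" and "B \<le>\<^sub>T C"
  shows "A \<oplus> B \<le>\<^sub>T C"
proof -
  obtain f where f: "\<And>n. eval C f [n] (if n \<in> A then 1 else 0)"
    using assms(1) unfolding turing_le_def by auto
  obtain g where g: "\<And>n. eval C g [n] (if n \<in> B then 1 else 0)"
    using assms(2) unfolding turing_le_def by auto
  (* Both branches are evaluated before one is selected, which is harmless as f and g are total. *)
  let ?h = "Comp cond_prog [parity_prog, Comp f [half_prog], Comp g [half_prog]]"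
  have "eval C ?h [n] (if n \<in> A \<oplus> B then 1 else 0)" for n
  proof (rule eval_Comp)
    let ?a = "if n div 2 \<in> A then 1 else 0 :: nat" and ?b = "if n div 2 \<in> B then 1 else 0 :: nat"
    show "list_all2 (\<lambda>g y. eval C g [n] y) [parity_prog, Comp f [half_prog], Comp g [half_prog]]
        [n mod 2, ?a, ?b]"
      using eval_parity eval_Comp_unary[OF eval_half f] eval_Comp_unary[OF eval_half g]
      by auto
    have "(if n mod 2 = 0 then ?a else ?b) = (if n \<in> A \<oplus> B then 1 else 0)"
      by (simp add: mem_join even_iff_mod_2_eq_zero)
    then show "eval C cond_prog [n mod 2, ?a, ?b] (if n \<in> A \<oplus> B then 1 else 0)"
      using eval_cond[of C "n mod 2" ?a ?b] by (simp only:)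
  qed
  then show ?thesis unfolding turing_le_def by blast
qed

lemma join_mono_turing_le: "A \<le>\<^sub>T B \<Longrightarrow> A \<oplus> C \<le>\<^sub>T B \<oplus> C"
  by (meson join_turing_le turing_le_join1 turing_le_join2 turing_le_trans)

lemma join_assoc_turing_le: "(A \<oplus> B) \<oplus> C \<le>\<^sub>T A \<oplus> (B \<oplus> C)"
  by (meson join_turing_le turing_le_join1 turing_le_join2 turing_le_trans)

section \<open>Closing off under solutions\<close>

instance prog :: countable
  by countable_datatype

text \<open>
  An index \<open>e\<close> that is not the code of a program computing a characteristic function
  still yields some set; such sets need not be computable from \<open>A\<close>.
\<close>

definition computed_set :: "nat set \<Rightarrow> nat \<Rightarrow> nat set" where
  "computed_set A e = {n. eval A (from_nat e) [n] 1}"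

lemma turing_le_computed_set:
  assumes "B \<le>\<^sub>T A"
  shows "\<exists>e. B = computed_set A e"
proof -
  obtain f where f: "\<And>n. eval A f [n] (if n \<in> B then 1 else 0)"
    using assms unfolding turing_le_def by auto
  have "n \<in> B \<longleftrightarrow> eval A f [n] 1" for n
    using f[of n] eval_deterministic[of A f "[n]" 0 1] by (cases "n \<in> B") auto
  then have "B = computed_set A (to_nat f)"
    by (auto simp: computed_set_def)
  then show ?thesis ..
qed

text \<open>
  Stage \<open>s\<close> decodes to a pair \<open>(n, e)\<close> and treats the \<open>e\<close>-th set computed by the \<open>n\<close>-th set of the
  sequence. The \<open>n\<close>-th set is available by then because the pairing function dominates its
  arguments.
\<close>

function extension_sequence ::
    "(nat set \<Rightarrow> nat set \<Rightarrow> nat set) \<Rightarrow> nat set \<Rightarrow> nat \<Rightarrow> nat set" where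
  "extension_sequence ext X 0 = X"
| "extension_sequence ext X (Suc s) =
     ext (extension_sequence ext X s)
       (computed_set (extension_sequence ext X (fst (prod_decode s))) (snd (prod_decode s)))"
  by pat_completeness auto
termination
proof (relation "measure (\<lambda>(ext, X, s). s)", goal_cases)
  case (3 ext X s)
  have "fst (prod_decode s) \<le> s"
    using le_prod_encode_1[of "fst (prod_decode s)" "snd (prod_decode s)"] by simp
  then show ?case by simp
qed auto

text \<open>
  Solving one instance at a time suffices to make a whole problem hold: the ideal generated by an
  extension sequence is countable, so every instance in it gets its own stage. The
  predicate \<open>good\<close> is whatever invariant the single steps preserve.
\<close>

lemma ideal_from_extensions:
  assumes start: "good X"
    and step: "\<And>W Y. good W \<Longrightarrow> Y \<le>\<^sub>T W \<Longrightarrow> Y \<in> Domain P \<Longrightarrow>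
      \<exists>W'. good W' \<and> W \<le>\<^sub>T W' \<and> (\<exists>V. V \<le>\<^sub>T W' \<and> (Y, V) \<in> P)"
  obtains M where "turing_ideal M" and "X \<in> M" and "holds_in M P"
    and "\<And>Y. Y \<in> M \<Longrightarrow> \<exists>W. good W \<and> Y \<le>\<^sub>T W"
proof -
  (* The bookkeeping may also propose sets that are no instances or are not computable from W;
     these are answered by W itself, so that the choice of extension is total. *)
  define extends where "extends W Y W' \<longleftrightarrow> good W' \<and> W \<le>\<^sub>T W' \<and>
    (Y \<le>\<^sub>T W \<longrightarrow> Y \<in> Domain P \<longrightarrow> (\<exists>V. V \<le>\<^sub>T W' \<and> (Y, V) \<in> P))" for W Y W'
  have "\<exists>W'. good W \<longrightarrow> extends W Y W'" for W Y
    unfolding extends_def using step[of W Y] turing_le_refl[of W] by blast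
  then obtain ext where ext: "\<And>W Y. good W \<Longrightarrow> extends W Y (ext W Y)"
    by metis
  define W where "W = extension_sequence ext X"
  have W_Suc: "W (Suc s) = ext (W s) (computed_set (W (fst (prod_decode s))) (snd (prod_decode s)))"
    for s by (simp add: W_def)
  have good: "good (W s)" for s
  proof (induction s)
    case 0
    show ?case by (simp add: W_def start)
  next
    case (Suc s)
    then show ?case using ext unfolding W_Suc extends_def by blast
  qed
  have increasing: "W m \<le>\<^sub>T W n" if "m \<le> n" for m n
    using that
  proof (induction rule: dec_induct)
    case base
    show ?case by (rule turing_le_refl)
  next
    case (step n)
    have "W n \<le>\<^sub>T W (Suc n)"
      using ext[OF good] unfolding W_Suc extends_def by blast
    with step.IH show ?case by (rule turing_le_trans)
  qed
  let ?M = "{Y. \<exists>n. Y \<le>\<^sub>T W n}"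
  show ?thesis
  proof
    have "A \<oplus> B \<le>\<^sub>T W (max m n)" if "A \<le>\<^sub>T W m" "B \<le>\<^sub>T W n" for A B m n
      using that increasing[of m "max m n"] increasing[of n "max m n"]
      by (auto intro: join_turing_le turing_le_trans)
    then show "turing_ideal ?M"
      unfolding turing_ideal_def using turing_le_refl turing_le_trans by blast
  next
    have "X = W 0" by (simp add: W_def)
    then show "X \<in> ?M" using turing_le_refl by blast
  next
    show "holds_in ?M P"
      unfolding holds_in_def
    proof
      fix Y assume "Y \<in> Domain P \<inter> ?M"
      then obtain n where Y: "Y \<in> Domain P" "Y \<le>\<^sub>T W n" by auto
      obtain e where e: "Y = computed_set (W n) e"
        using turing_le_computed_set[OF Y(2)] ..
      let ?s = "prod_encode (n, e)"
      have "Y \<le>\<^sub>T W ?s"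
        using Y(2) increasing[OF le_prod_encode_1] by (rule turing_le_trans)
      moreover have "W (Suc ?s) = ext (W ?s) Y"
        by (simp add: W_Suc e)
      ultimately show "\<exists>V \<in> ?M. (Y, V) \<in> P"
        using ext[OF good, of ?s Y] Y(1) unfolding extends_def mem_Collect_eq Bex_def by metis
    qed
  next
    fix Y assume "Y \<in> ?M"
    then show "\<exists>W. good W \<and> Y \<le>\<^sub>T W" using good by blast
  qed
qed

section \<open>Safe extensions\<close>

lemma small_subset: "smallness_notion small \<Longrightarrow> small \<B> \<Longrightarrow> \<A> \<subseteq> \<B> \<Longrightarrow> small \<A>"
  unfolding smallness_notion_def by blast

definition turing_upward_closed :: "nat set set \<Rightarrow> bool" where
  "turing_upward_closed U \<longleftrightarrow> (\<forall>A \<in> U. \<forall>B. A \<le>\<^sub>T B \<longrightarrow> B \<in> U)"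

definition safe :: "(nat set set \<Rightarrow> bool) \<Rightarrow> nat set set \<Rightarrow> nat set \<Rightarrow> bool" where
  "safe small U W \<longleftrightarrow> small {Z. W \<oplus> Z \<in> U}"

text \<open>
  This is why safety can be preserved at all.
  A pair \<open>(Z, V)\<close> with \<open>(W \<oplus> Z) \<oplus> V \<in> U\<close> is coded by the single set \<open>Z \<oplus> V\<close> in the
  small class \<open>{Z. W \<oplus> Z \<in> U}\<close>, and almost all sections of a small class are small.
\<close>

lemma small_unsafe_joins:
  assumes small: "smallness_notion small"
    and up: "turing_upward_closed U"
    and "safe small U W"
  shows "small {Z. \<not> safe small U (W \<oplus> Z)}"
proof -
  let ?S = "{Z. W \<oplus> Z \<in> U}"
  have "small {Z. \<not> small {V. Z \<oplus> V \<in> ?S}}"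
    using small \<open>safe small U W\<close> unfolding smallness_notion_def safe_def by blast
  moreover have "safe small U (W \<oplus> Z)" if "small {V. Z \<oplus> V \<in> ?S}" for Z
    unfolding safe_def
    by (rule small_subset[OF small that])
      (use up join_assoc_turing_le in \<open>auto simp: turing_upward_closed_def\<close>)
  ultimately show ?thesis
    by (auto intro: small_subset[OF small])
qed

text \<open>
  The class of \<open>Z\<close> that help to solve \<open>Y\<close> is not small, hence not contained in the small class of
  \<open>Z\<close> that destroy safety.
\<close>

lemma safe_extension:
  assumes small: "smallness_notion small"
    and up: "turing_upward_closed U"
    and "safe small U W"
    and "\<not> small (solving_class P Y)" and "Y \<le>\<^sub>T W"
  shows "\<exists>W'. safe small U W' \<and> W \<le>\<^sub>T W' \<and> (\<exists>V. V \<le>\<^sub>T W' \<and> (Y, V) \<in> P)"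
proof -
  have "small {Z. \<not> safe small U (W \<oplus> Z)}"
    using small up \<open>safe small U W\<close> by (rule small_unsafe_joins)
  with assms(4) have "\<not> solving_class P Y \<subseteq> {Z. \<not> safe small U (W \<oplus> Z)}"
    using small_subset[OF small] by blast
  then obtain Z V where "safe small U (W \<oplus> Z)" "V \<le>\<^sub>T Y \<oplus> Z" "(Y, V) \<in> P"
    unfolding solving_class_def by auto
  moreover have "Y \<oplus> Z \<le>\<^sub>T W \<oplus> Z"
    using \<open>Y \<le>\<^sub>T W\<close> by (rule join_mono_turing_le)
  ultimately show ?thesis
    using turing_le_join1 turing_le_trans by blast
qed

lemma safe_not_mem:
  assumes small: "smallness_notion small"
    and up: "turing_upward_closed U"
    and "safe small U W"
  shows "W \<notin> U"
proof
  assume "W \<in> U"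
  then have "{Z. W \<oplus> Z \<in> U} = UNIV"
    using up turing_le_join1 unfolding turing_upward_closed_def by blast
  with \<open>safe small U W\<close> small show False
    unfolding safe_def smallness_notion_def by simp
qed

section \<open>Separating the problems\<close>

theorem theorem2p5:
  fixes small :: "nat set set \<Rightarrow> bool" and P Q :: problem and X :: "nat set"
  assumes "smallness_notion small"
    and "frequently_solved small P"
    and "rarely_solved_instance small Q X"
  shows "\<not> Q \<le>\<^sub>\<omega> P"
proof
  assume reducible: "Q \<le>\<^sub>\<omega> P"
  define U where "U = {A. \<exists>Y. Y \<le>\<^sub>T A \<and> (X, Y) \<in> Q}"
  have up: "turing_upward_closed U"
    using turing_le_trans unfolding turing_upward_closed_def U_def by blast
  have X: "X \<in> Domain Q" "safe small U X"
    using assms(3) unfolding rarely_solved_instance_def solving_class_def safe_def U_def by auto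
  have step: "\<exists>W'. safe small U W' \<and> W \<le>\<^sub>T W' \<and> (\<exists>V. V \<le>\<^sub>T W' \<and> (Y, V) \<in> P)"
    if "safe small U W" "Y \<le>\<^sub>T W" "Y \<in> Domain P" for W Y
    using safe_extension[OF assms(1) up] that assms(2) unfolding frequently_solved_def by blast
  obtain M where M: "turing_ideal M" "X \<in> M" "holds_in M P"
    "\<And>Y. Y \<in> M \<Longrightarrow> \<exists>W. safe small U W \<and> Y \<le>\<^sub>T W"
    using ideal_from_extensions[where good = "safe small U" and P = P, OF X(2) step] by blast
  have "holds_in M Q"
    using reducible M(1,3) unfolding omega_reducible_def by blast
  then obtain Y where Y: "Y \<in> M" "(X, Y) \<in> Q"
    using X(1) M(2) unfolding holds_in_def by blast
  then obtain W where "safe small U W" "Y \<le>\<^sub>T W"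
    using M(4) by blast
  with Y(2) show False
    using safe_not_mem[OF assms(1) up] unfolding U_def by blast
qed

end
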